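(* Let $f,g:[0,b]\to[0,b]$ be continuous, strictly increasing Allee maps with fixed points $0<A_f<K_f$ and $0<A_g<K_g$ respectively, let $p\in(0,1)$, and let $\{X_n\}_{n=0}^\infty$ be the random dynamical system with $X_0=x_0\in[0,b]$ in which $X_{n+1}=f(X_n)$ with probability $p$ and $X_{n+1}=g(X_n)$ with probability $1-p$, the choices being independent over $n$. Assume $A_f<A_g<K_f<K_g$. Put $$p_0= P\left(\lim_{n\to\infty}X_n=0\right),\qquad p_1= P\left(\exists n_0\in\mathbb{N}:\ X_n\in[K_f,K_g]\ \ \forall n\ge n_0\right).$$ Then: (i) if $x_0\le A_f$, then $p_0=1$; (ii) if $x_0\ge A_g$, then $p_1=1$; (iii) if $x_0\in(A_f,A_g)$, then $p_0>0$, $p_1>0$ and $p_0+p_1=1$.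
   Context: Here $0<b\le\infty$, and if $b=\infty$ then $[0,b]$ is understood as $[0,\infty)$. A function $f:[0,b]\to[0,b]$ is called an Allee map if: it has exactly three fixed points, namely $0$, which is a stable fixed point, an unstable fixed point (threshold) $A_f>0$, and a fixed point $K_f>A_f$ (which may or may not be stable); $f(x)<x$ for all $x\in(0,A_f)\cup(K_f,b]$; and $f(x)>x$ for all $x\in(A_f,K_f)$. The notation $A_g,K_g$ is the analogous one for $g$. Formally, $X_{n+1}=H_n(X_n)$, where the $H_n$ are i.i.d. random functions with $P(H_n=f)=p$ and $P(H_n=g)=1-p$; $x_0$ is deterministic. *)

theory Defs
  imports "HOL-Probability.Probability"
begin

text \<open>The state space \<open>[0,b]\<close> for \<open>0 < b \<le> \<infinity>\<close>; since its elements are real numbers, it is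
  \<open>[0,\<infinity>)\<close> when \<open>b = \<infinity>\<close>.\<close>

definition state_space :: "ereal \<Rightarrow> real set" where
  "state_space b = {x. 0 \<le> x \<and> ereal x \<le> b}"

text \<open>Stability is understood in the sense of Lyapunov, relative to the state space.\<close>

definition stable_fixed_point :: "real set \<Rightarrow> (real \<Rightarrow> real) \<Rightarrow> real \<Rightarrow> bool" where
  "stable_fixed_point S f z \<longleftrightarrow> z \<in> S \<and> f z = z \<and>
     (\<forall>\<epsilon>>0. \<exists>\<delta>>0. \<forall>x\<in>S. \<bar>x - z\<bar> < \<delta> \<longrightarrow> (\<forall>n. \<bar>(f ^^ n) x - z\<bar> < \<epsilon>))"

definition unstable_fixed_point :: "real set \<Rightarrow> (real \<Rightarrow> real) \<Rightarrow> real \<Rightarrow> bool" where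
  "unstable_fixed_point S f z \<longleftrightarrow> z \<in> S \<and> f z = z \<and> \<not> stable_fixed_point S f z"

text \<open>\<open>allee_map b f A K\<close>: \<open>f\<close> restricts to an Allee map of \<open>[0,b]\<close> with threshold \<open>A\<close> and largest
  fixed point \<open>K\<close>. The values of \<open>f\<close> outside \<open>[0,b]\<close> are irrelevant.\<close>

definition allee_map :: "ereal \<Rightarrow> (real \<Rightarrow> real) \<Rightarrow> real \<Rightarrow> real \<Rightarrow> bool" where
  "allee_map b f A K \<longleftrightarrow>
     f \<in> state_space b \<rightarrow> state_space b \<and>
     0 < A \<and> A < K \<and>
     {x \<in> state_space b. f x = x} = {0, A, K} \<and>
     stable_fixed_point (state_space b) f 0 \<and>
     unstable_fixed_point (state_space b) f A \<and>
     (\<forall>x\<in>state_space b. 0 < x \<and> x < A \<or> K < x \<longrightarrow> f x < x) \<and>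
     (\<forall>x\<in>state_space b. A < x \<and> x < K \<longrightarrow> x < f x)"

end

theory Submission
  imports Defs
begin

text \<open>
  Along almost every path both maps are applied infinitely often. A monotone orbit then converges to
  a point fixed by whichever map is used infinitely often; this drives every orbit in
  \<open>[0,A\<^sub>f]\<close> to \<open>0\<close>, the only fixed point of \<open>g\<close> there, and every orbit above \<open>A\<^sub>g\<close> into
  \<open>[K\<^sub>f,K\<^sub>g]\<close>, as \<open>f\<close> and \<open>g\<close> have no common positive fixed point. From \<open>(A\<^sub>f,A\<^sub>g)\<close> a run of
  \<open>g\<close>'s (of \<open>f\<close>'s) leads below \<open>A\<^sub>f\<close> (above \<open>A\<^sub>g\<close>); fixing \<open>c\<close> in this interval, a common run
  length suffices for \<open>g\<close> from all points \<open>\<le> c\<close> and for \<open>f\<close> from all points \<open>\<ge> c\<close>,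
  so the probability of remaining in the interval decays geometrically.
\<close>

section \<open>Orbits in the state space\<close>

lemma state_space_downward_closed:
  "x \<in> state_space b \<Longrightarrow> 0 \<le> y \<Longrightarrow> y \<le> x \<Longrightarrow> y \<in> state_space b"
  by (auto simp: state_space_def intro: order_trans[of "ereal y" "ereal x"])

lemma INFM_nat_shift:
  fixes P :: "nat \<Rightarrow> bool"
  assumes "\<exists>\<^sub>\<infinity>n. P n"
  shows "\<exists>\<^sub>\<infinity>n. P (n + m)"
  unfolding INFM_nat_le
proof
  fix k
  obtain n where "k + m \<le> n" "P n"
    using assms unfolding INFM_nat_le by blast
  then show "\<exists>n\<ge>k. P (n + m)"
    by (intro exI[of _ "n - m"]) auto
qed

text \<open>Along the times at which \<open>h\<close> is applied, the states and their images both
  tend to \<open>L\<close>, so continuity identifies \<open>h L\<close> with \<open>L\<close>. These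
  times may be arbitrarily sparse, so one random orbit can be tested against \<open>f\<close> and
  \<open>g\<close> separately.\<close>

lemma orbit_limit_fixed:
  fixes x :: "nat \<Rightarrow> 'a::t2_space"
  assumes h: "continuous_on S h" and x: "\<And>n. x n \<in> S" "L \<in> S" "x \<longlonglongrightarrow> L"
    and io: "\<exists>\<^sub>\<infinity>n. x (Suc n) = h (x n)"
  shows "h L = L"
proof -
  obtain r :: "nat \<Rightarrow> nat" where r: "strict_mono r" "\<And>k. x (Suc (r k)) = h (x (r k))"
    using infinite_enumerate[of "{n. x (Suc n) = h (x n)}"] io
    by (auto simp: frequently_cofinite)
  have "(\<lambda>k. x (r k)) \<longlonglongrightarrow> L"
    using LIMSEQ_subseq_LIMSEQ[OF x(3) r(1)] by (simp add: o_def)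
  then have "(\<lambda>k. h (x (r k))) \<longlonglongrightarrow> h L"
    by (rule continuous_on_tendsto_compose[OF h]) (simp_all add: x)
  moreover have "(\<lambda>k. x (Suc (r k))) \<longlonglongrightarrow> L"
    using LIMSEQ_subseq_LIMSEQ[OF LIMSEQ_Suc[OF x(3)] r(1)] by (simp add: o_def)
  ultimately show ?thesis
    using r(2) LIMSEQ_unique by auto
qed

text \<open>The last conclusion ranges over all \<open>h\<close>, so that a single limit can be
  shown fixed by both maps of a pair. The limit stays in the state space because it lies in
  \<open>{a..x 0}\<close> with \<open>0 \<le> a\<close>.\<close>

lemma decreasing_orbit_limit:
  assumes x: "decseq x" "\<And>n. x n \<in> state_space b" "\<And>n. a \<le> x n" and "0 \<le> a"
  obtains L where "x \<longlonglongrightarrow> L" "a \<le> L" "L \<le> x 0" "L \<in> state_space b"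
    "\<And>h. continuous_on (state_space b) h \<Longrightarrow> \<exists>\<^sub>\<infinity>n. x (Suc n) = h (x n) \<Longrightarrow> h L = L"
proof -
  obtain L where L: "x \<longlonglongrightarrow> L" "\<And>n. L \<le> x n"
    using decseq_convergent[of x a] x by blast
  have "a \<le> L"
    using LIMSEQ_le_const[OF L(1)] x(3) by blast
  moreover have "L \<in> state_space b"
    using state_space_downward_closed[OF x(2)[of 0], of L] L(2) \<open>0 \<le> a\<close> calculation by auto
  ultimately show ?thesis
    using that[of L] L orbit_limit_fixed[of "state_space b" _ x L] x(2) by auto
qed

lemma increasing_orbit_limit:
  assumes x: "incseq x" "\<And>n. x n \<in> state_space b" "\<And>n. x n \<le> a" and "a \<in> state_space b"
  obtains L where "x \<longlonglongrightarrow> L" "L \<le> a" "x 0 \<le> L" "L \<in> state_space b"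
    "\<And>h. continuous_on (state_space b) h \<Longrightarrow> \<exists>\<^sub>\<infinity>n. x (Suc n) = h (x n) \<Longrightarrow> h L = L"
proof -
  obtain L where L: "x \<longlonglongrightarrow> L" "\<And>n. x n \<le> L"
    using incseq_convergent[of x a] x by blast
  have "L \<le> a"
    using LIMSEQ_le_const2[OF L(1)] x(3) by blast
  moreover have "0 \<le> x 0"
    using x(2)[of 0] by (simp add: state_space_def)
  ultimately have "L \<in> state_space b"
    using state_space_downward_closed[OF assms(4), of L] L(2)[of 0] by auto
  then show ?thesis
    using that[of L] L \<open>L \<le> a\<close> orbit_limit_fixed[of "state_space b" _ x L] x(2) by auto
qed

section \<open>Increasing Allee maps\<close>

locale increasing_allee_map =
  fixes b :: ereal and h :: "real \<Rightarrow> real" and A K :: real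
  assumes allee: "allee_map b h A K"
    and continuous: "continuous_on (state_space b) h"
    and increasing: "strict_mono_on (state_space b) h"
begin

abbreviation "S \<equiv> state_space b"

lemma closed_step: "x \<in> S \<Longrightarrow> h x \<in> S"
  and A_pos: "0 < A" and A_less_K: "A < K"
  and fixed_in: "0 \<in> S" "A \<in> S" "K \<in> S"
  and fixed: "h 0 = 0" "h A = A" "h K = K"
  and fixed_cases: "x \<in> S \<Longrightarrow> h x = x \<Longrightarrow> x = 0 \<or> x = A \<or> x = K"
  using allee unfolding allee_map_def by auto

lemma strict_mono_step: "x \<in> S \<Longrightarrow> y \<in> S \<Longrightarrow> x < y \<Longrightarrow> h x < h y"
  using increasing by (rule strict_mono_onD)

lemma mono_step: "x \<in> S \<Longrightarrow> y \<in> S \<Longrightarrow> x \<le> y \<Longrightarrow> h x \<le> h y"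
  using strict_mono_step[of x y] by (cases "x = y") auto

lemma nonneg: "x \<in> S \<Longrightarrow> 0 \<le> x"
  by (simp add: state_space_def)

lemma step_le: "x \<in> S \<Longrightarrow> x \<le> A \<or> K \<le> x \<Longrightarrow> h x \<le> x"
  using allee fixed nonneg[of x] unfolding allee_map_def
  by (cases "x = 0 \<or> x = A \<or> x = K") (auto intro: less_imp_le)

lemma step_ge: "x \<in> S \<Longrightarrow> A \<le> x \<Longrightarrow> x \<le> K \<Longrightarrow> x \<le> h x"
  using allee fixed unfolding allee_map_def
  by (cases "x = A \<or> x = K") (auto intro: less_imp_le)

text \<open>An increasing map cannot carry a point across one of its fixed points.\<close>

lemma le_A_step: "x \<in> S \<Longrightarrow> x \<le> A \<Longrightarrow> h x \<le> A"
  and ge_A_step: "x \<in> S \<Longrightarrow> A \<le> x \<Longrightarrow> A \<le> h x"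
  and le_K_step: "x \<in> S \<Longrightarrow> x \<le> K \<Longrightarrow> h x \<le> K"
  and ge_K_step: "x \<in> S \<Longrightarrow> K \<le> x \<Longrightarrow> K \<le> h x"
  and less_K_step: "x \<in> S \<Longrightarrow> x < K \<Longrightarrow> h x < K"
  and greater_K_step: "x \<in> S \<Longrightarrow> K < x \<Longrightarrow> K < h x"
  using mono_step[of x A] mono_step[of A x] mono_step[of x K] mono_step[of K x]
    strict_mono_step[of x K] strict_mono_step[of K x] fixed fixed_in by auto

lemma funpow_closed: "x \<in> S \<Longrightarrow> (h ^^ n) x \<in> S"
  by (induction n) (auto intro: closed_step)

lemma funpow_mono: "x \<in> S \<Longrightarrow> y \<in> S \<Longrightarrow> x \<le> y \<Longrightarrow> (h ^^ n) x \<le> (h ^^ n) y"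
  by (induction n) (auto intro: mono_step funpow_closed)

text \<open>Iterates staying above \<open>a\<close> would decrease to a fixed point in
  \<open>{a..x}\<close>, but there is none strictly between \<open>0\<close> and
  \<open>A\<close>.\<close>

lemma iterates_drop_below:
  assumes x: "x \<in> S" "x < A" and a: "0 < a"
  shows "\<exists>n. (h ^^ n) x \<le> a"
proof (rule ccontr)
  assume "\<not> ?thesis"
  then have gt: "a < (h ^^ n) x" for n
    by (simp add: not_le)
  have le: "(h ^^ n) x \<le> A" for n
    using x by (induction n) (auto intro: le_A_step funpow_closed)
  have mono: "decseq (\<lambda>n. (h ^^ n) x)"
    using le x by (auto intro!: decseq_SucI step_le funpow_closed)
  obtain L where L: "a \<le> L" "L \<le> (h ^^ 0) x" "L \<in> S"
    "\<And>h'. continuous_on S h' \<Longrightarrow> \<exists>\<^sub>\<infinity>n. (h ^^ Suc n) x = h' ((h ^^ n) x) \<Longrightarrow> h' L = L"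
    using decreasing_orbit_limit[OF mono funpow_closed[OF x(1)] less_imp_le[OF gt] less_imp_le[OF a]] by blast
  have "h L = L"
    by (rule L(4)[OF continuous]) simp
  then show False
    using fixed_cases[of L] L x a A_less_K by auto
qed

text \<open>Iterates staying below \<open>a\<close> would increase to a fixed point in
  \<open>{x..a}\<close>, but there is none strictly between \<open>A\<close> and
  \<open>K\<close>.\<close>

lemma iterates_rise_above:
  assumes x: "x \<in> S" "A < x" and a: "a < K"
  shows "\<exists>n. a \<le> (h ^^ n) x"
proof (rule ccontr)
  assume "\<not> ?thesis"
  then have less: "(h ^^ n) x < a" for n
    by (simp add: not_le)
  \<comment> \<open>The negated claim at \<open>n = 0\<close> gives \<open>x < a\<close>, so
    \<open>a\<close> lies between \<open>0\<close> and \<open>K\<close>.\<close>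
  have "a \<in> S"
    using state_space_downward_closed[OF fixed_in(3), of a] less[of 0] a x A_pos by auto
  have ge: "A \<le> (h ^^ n) x" for n
    using x by (induction n) (auto intro: ge_A_step funpow_closed)
  have mono: "incseq (\<lambda>n. (h ^^ n) x)"
    using ge less_imp_le[OF less_trans[OF less a]] x
    by (auto intro!: incseq_SucI step_ge funpow_closed)
  obtain L where L: "L \<le> a" "(h ^^ 0) x \<le> L" "L \<in> S"
    "\<And>h'. continuous_on S h' \<Longrightarrow> \<exists>\<^sub>\<infinity>n. (h ^^ Suc n) x = h' ((h ^^ n) x) \<Longrightarrow> h' L = L"
    using increasing_orbit_limit[OF mono funpow_closed[OF x(1)] less_imp_le[OF less] \<open>a \<in> S\<close>] by blast
  have "h L = L"
    by (rule L(4)[OF continuous]) simp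
  then show False
    using fixed_cases[of L] L x a A_pos by auto
qed

end

section \<open>Orbits of a pair of increasing Allee maps\<close>

locale allee_pair =
  F: increasing_allee_map b f A\<^sub>f K\<^sub>f + G: increasing_allee_map b g A\<^sub>g K\<^sub>g
  for b f g A\<^sub>f K\<^sub>f A\<^sub>g K\<^sub>g +
  assumes A_less: "A\<^sub>f < A\<^sub>g" and A_less_K: "A\<^sub>g < K\<^sub>f" and K_less: "K\<^sub>f < K\<^sub>g"
begin

abbreviation "S \<equiv> state_space b"

text \<open>Isolates the pathwise part of the argument: every path of the random system is such an
  orbit, and probability enters only through how often and in which order the maps occur.\<close>

definition orbit :: "(nat \<Rightarrow> real) \<Rightarrow> bool" where
  "orbit x \<longleftrightarrow> x 0 \<in> S \<and> (\<forall>n. x (Suc n) = f (x n) \<or> x (Suc n) = g (x n))"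

lemma orbit_step: "orbit x \<Longrightarrow> x (Suc n) = f (x n) \<or> x (Suc n) = g (x n)"
  by (simp add: orbit_def)

lemma orbit_closed: "orbit x \<Longrightarrow> x n \<in> S"
  by (induction n) (metis F.closed_step G.closed_step orbit_def)+

lemma orbit_invariant:
  assumes "orbit x" "P (x m)"
    and "\<And>y. y \<in> S \<Longrightarrow> P y \<Longrightarrow> P (f y) \<and> P (g y)"
  shows "P (x (m + n))"
proof (induction n)
  case (Suc n)
  then show ?case
    using assms(3)[of "x (m + n)"] orbit_closed[OF assms(1)] orbit_step[OF assms(1), of "m + n"]
    by auto
qed (use assms in simp)

text \<open>\<open>f\<close> respects its fixed point \<open>A\<^sub>f\<close>, and \<open>g\<close>
  does not increase points below its own threshold \<open>A\<^sub>g\<close>.\<close>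

lemma orbit_stays_low:
  assumes "orbit x" "x m \<le> A\<^sub>f"
  shows "x (m + n) \<le> A\<^sub>f"
proof (rule orbit_invariant[where P = "\<lambda>y. y \<le> A\<^sub>f", OF assms])
  fix y assume "y \<in> S" "y \<le> A\<^sub>f"
  then show "f y \<le> A\<^sub>f \<and> g y \<le> A\<^sub>f"
    using F.le_A_step[of y] G.step_le[of y] A_less by auto
qed

text \<open>\<open>g\<close> respects its fixed point \<open>A\<^sub>g\<close>; \<open>f\<close>
  does not decrease points up to \<open>K\<^sub>f\<close> and keeps larger ones above
  \<open>K\<^sub>f\<close>.\<close>

lemma orbit_stays_high:
  assumes "orbit x" "A\<^sub>g \<le> x m"
  shows "A\<^sub>g \<le> x (m + n)"
proof (rule orbit_invariant[where P = "\<lambda>y. A\<^sub>g \<le> y", OF assms])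
  fix y assume y: "y \<in> S" "A\<^sub>g \<le> y"
  then show "A\<^sub>g \<le> f y \<and> A\<^sub>g \<le> g y"
    using F.ge_K_step[of y] F.step_ge[of y] G.ge_A_step[of y] A_less A_less_K
    by (cases "y \<le> K\<^sub>f") auto
qed

text \<open>On this interval \<open>f\<close> moves points down, but not past
  \<open>K\<^sub>f\<close>, and \<open>g\<close> moves them up, but not past
  \<open>K\<^sub>g\<close>.\<close>

lemma orbit_stays_between:
  assumes "orbit x" "x m \<in> {K\<^sub>f..K\<^sub>g}"
  shows "x (m + n) \<in> {K\<^sub>f..K\<^sub>g}"
proof (rule orbit_invariant[where P = "\<lambda>y. y \<in> {K\<^sub>f..K\<^sub>g}", OF assms])
  fix y assume y: "y \<in> S" "y \<in> {K\<^sub>f..K\<^sub>g}"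
  then show "f y \<in> {K\<^sub>f..K\<^sub>g} \<and> g y \<in> {K\<^sub>f..K\<^sub>g}"
    using F.ge_K_step[of y] F.step_le[of y] G.le_K_step[of y] G.step_ge[of y] A_less_K by auto
qed

text \<open>Neither map increases points of the low region, so the orbit decreases. Infinitely many
  uses of \<open>g\<close> are what matters: \<open>f\<close> alone could rest at
  \<open>A\<^sub>f\<close>, whereas \<open>g\<close> fixes only \<open>0\<close> there.\<close>

lemma orbit_tendsto_0:
  assumes x: "orbit x" "x m \<le> A\<^sub>f" and io: "\<exists>\<^sub>\<infinity>n. x (Suc n) = g (x n)"
  shows "x \<longlonglongrightarrow> 0"
proof -
  define y where "y n = x (n + m)" for n
  have y: "y n \<in> S" "y n \<le> A\<^sub>f" "y (Suc n) = f (y n) \<or> y (Suc n) = g (y n)" for n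
    using orbit_closed[OF x(1)] orbit_stays_low[OF x, of n] orbit_step[OF x(1), of "n + m"]
    by (auto simp: y_def add.commute)
  have io_y: "\<exists>\<^sub>\<infinity>n. y (Suc n) = g (y n)"
    using INFM_nat_shift[OF io, of m] by (simp add: y_def)
  have mono: "decseq y"
  proof (rule decseq_SucI)
    fix n show "y (Suc n) \<le> y n"
      using F.step_le[of "y n"] G.step_le[of "y n"] y[of n] A_less by auto
  qed
  obtain L where L: "y \<longlonglongrightarrow> L" "L \<le> y 0" "L \<in> S" "g L = L"
    by (rule decreasing_orbit_limit[OF mono y(1) G.nonneg[OF y(1)] order_refl])
      (use io_y G.continuous in blast)
  have "L = 0"
    using G.fixed_cases[of L] L y(2)[of 0] A_less A_less_K K_less by auto
  then show ?thesis
    using L(1) unfolding y_def by (simp add: LIMSEQ_offset)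
qed

text \<open>By invariance of the interval one visit is enough. An orbit that avoids it stays on one
  side, is monotone there, and would converge to an impossible fixed point.\<close>

lemma orbit_eventually_between:
  assumes x: "orbit x" "A\<^sub>g \<le> x m"
    and io: "\<exists>\<^sub>\<infinity>n. x (Suc n) = f (x n)" "\<exists>\<^sub>\<infinity>n. x (Suc n) = g (x n)"
  shows "\<exists>n\<^sub>0. \<forall>n\<ge>n\<^sub>0. x n \<in> {K\<^sub>f..K\<^sub>g}"
proof -
  define y where "y n = x (n + m)" for n
  have y: "y n \<in> S" "A\<^sub>g \<le> y n" "y (Suc n) = f (y n) \<or> y (Suc n) = g (y n)" for n
    using orbit_closed[OF x(1)] orbit_stays_high[OF x, of n] orbit_step[OF x(1), of "n + m"]
    by (auto simp: y_def add.commute)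
  have io_y: "\<exists>\<^sub>\<infinity>n. y (Suc n) = h (y n)" if "\<exists>\<^sub>\<infinity>n. x (Suc n) = h (x n)" for h
    using INFM_nat_shift[OF that, of m] by (simp add: y_def)
  have "\<exists>n. y n \<in> {K\<^sub>f..K\<^sub>g}"
  proof (rule ccontr)
    assume "\<not> ?thesis"
    then have out: "y n < K\<^sub>f \<or> K\<^sub>g < y n" for n
      by (auto simp: not_le)
    consider "y 0 < K\<^sub>f" | "K\<^sub>g < y 0"
      using out by blast
    then show False
    proof cases
      case 1
      \<comment> \<open>The interval cannot be jumped over: \<open>f\<close> stays below
        \<open>K\<^sub>f\<close> and \<open>g\<close> reaches at most \<open>K\<^sub>g\<close>, so a
        value outside the interval is again below \<open>K\<^sub>f\<close>.\<close>
      have less: "y n < K\<^sub>f" for n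
      proof (induction n)
        case (Suc n)
        then show ?case
          using F.less_K_step[of "y n"] G.le_K_step[of "y n"] y[of n] out[of "Suc n"] K_less by auto
      qed (use 1 in simp)
      have "incseq y"
      proof (rule incseq_SucI)
        fix n show "y n \<le> y (Suc n)"
          using F.step_ge[of "y n"] G.step_ge[of "y n"] y[of n] less[of n] A_less K_less by auto
      qed
      \<comment> \<open>Between \<open>A\<^sub>g\<close> and \<open>K\<^sub>f\<close>,
        \<open>f\<close> fixes only \<open>K\<^sub>f\<close> and \<open>g\<close> fixes only
        \<open>A\<^sub>g\<close>.\<close>
      then obtain L where "L \<le> K\<^sub>f" "y 0 \<le> L" "L \<in> S" "f L = L" "g L = L"
        using increasing_orbit_limit[of y b "K\<^sub>f"] y less F.fixed_in io_y[OF io(1)] io_y[OF io(2)]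
          F.continuous G.continuous less_imp_le by metis
      then show False
        using F.fixed_cases[of L] G.fixed_cases[of L] y(2)[of 0] A_less A_less_K K_less F.A_pos by auto
    next
      case 2
      \<comment> \<open>Now \<open>f\<close> may undershoot \<open>K\<^sub>g\<close>, but it stays
        above \<open>K\<^sub>f\<close>, where the interval would catch the orbit.\<close>
      have greater: "K\<^sub>g < y n" for n
      proof (induction n)
        case (Suc n)
        then show ?case
          using F.greater_K_step[of "y n"] G.greater_K_step[of "y n"] y[of n] out[of "Suc n"] K_less
          by auto
      qed (use 2 in simp)
      have "decseq y"
      proof (rule decseq_SucI)
        fix n show "y (Suc n) \<le> y n"
          using F.step_le[of "y n"] G.step_le[of "y n"] y[of n] greater[of n] K_less by auto
      qed
      \<comment> \<open>All fixed points of \<open>f\<close> lie below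
        \<open>K\<^sub>g\<close>.\<close>
      then obtain L where "K\<^sub>g \<le> L" "L \<in> S" "f L = L"
        using decreasing_orbit_limit[of y b "K\<^sub>g"] y greater G.nonneg[OF G.fixed_in(3)]
          io_y[OF io(1)] F.continuous less_imp_le by metis
      then show False
        using F.fixed_cases[of L] A_less A_less_K K_less F.A_pos by auto
    qed
  qed
  then obtain n where "x (n + m) \<in> {K\<^sub>f..K\<^sub>g}"
    by (auto simp: y_def)
  then show ?thesis
    using orbit_stays_between[OF x(1)] by (metis le_add_diff_inverse)
qed

lemma orbit_run:
  assumes "\<And>i. i \<in> {n..<n + k} \<Longrightarrow> x (Suc i) = h (x i)"
  shows "x (n + k) = (h ^^ k) (x n)"
  using assms by (induction k) auto

text \<open>Iterates are monotone in the starting point, so on each side of \<open>c\<close> the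
  slowest escape is that of \<open>c\<close> itself.\<close>

lemma uniform_escape:
  assumes c: "A\<^sub>f < c" "c < A\<^sub>g"
  obtains N where "\<And>y. y \<in> S \<Longrightarrow> c \<le> y \<Longrightarrow> A\<^sub>g \<le> (f ^^ N) y"
    and "\<And>y. y \<in> S \<Longrightarrow> y \<le> c \<Longrightarrow> (g ^^ N) y \<le> A\<^sub>f"
proof -
  have cS: "c \<in> S"
    using state_space_downward_closed[OF G.fixed_in(2), of c] c F.A_pos by auto
  obtain k where k: "A\<^sub>g \<le> (f ^^ k) c"
    using F.iterates_rise_above[of c "A\<^sub>g"] cS c A_less_K by auto
  obtain l where l: "(g ^^ l) c \<le> A\<^sub>f"
    using G.iterates_drop_below[of c "A\<^sub>f"] cS c F.A_pos by auto
  have orb: "orbit (\<lambda>n. (f ^^ n) c)" "orbit (\<lambda>n. (g ^^ n) c)"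
    using cS by (auto simp: orbit_def)
  \<comment> \<open>Escaped orbits stay out, so both runs can be lengthened to the common length
    \<open>k + l\<close>.\<close>
  have "A\<^sub>g \<le> (f ^^ (k + l)) c"
    using orbit_stays_high[OF orb(1) k] .
  moreover have "(g ^^ (k + l)) c \<le> A\<^sub>f"
    using orbit_stays_low[OF orb(2) l, of k] by (simp only: add.commute)
  ultimately show ?thesis
    using that[of "k + l"] F.funpow_mono[of c _ "k + l"] G.funpow_mono[of _ c "k + l"] cS
    by (meson order_trans)
qed

end

section \<open>The random system\<close>

locale random_allee_system = allee_pair b f g A\<^sub>f K\<^sub>f A\<^sub>g K\<^sub>g + prob_space M
  for b f g A\<^sub>f K\<^sub>f A\<^sub>g K\<^sub>g and M :: "'a measure" +
  fixes p x\<^sub>0 :: real and H :: "nat \<Rightarrow> 'a \<Rightarrow> real \<Rightarrow> real" and X :: "nat \<Rightarrow> 'a \<Rightarrow> real"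
  assumes p_pos: "0 < p" and p_less_1: "p < 1"
    and indep: "indep_vars (\<lambda>_. count_space {f, g}) H UNIV"
    and prob_f: "\<And>n. prob {\<omega> \<in> space M. H n \<omega> = f} = p"
    and prob_g: "\<And>n. prob {\<omega> \<in> space M. H n \<omega> = g} = 1 - p"
    and x0_in: "x\<^sub>0 \<in> state_space b"
    and X_0: "\<And>\<omega>. \<omega> \<in> space M \<Longrightarrow> X 0 \<omega> = x\<^sub>0"
    and X_Suc: "\<And>n \<omega>. \<omega> \<in> space M \<Longrightarrow> X (Suc n) \<omega> = H n \<omega> (X n \<omega>)"
begin

section \<open>Measurability of the choices and of the process\<close>

lemma measurable_H [measurable]: "H n \<in> M \<rightarrow>\<^sub>M count_space {f, g}"
  using indep by (auto simp: indep_vars_def)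

text \<open>Measurability into \<open>count_space {f, g}\<close> includes having values there, so
  this holds everywhere and not just almost surely.\<close>

lemma H_cases: "\<omega> \<in> space M \<Longrightarrow> H n \<omega> = f \<or> H n \<omega> = g"
  using measurable_space[OF measurable_H, of \<omega> n] by auto

text \<open>\<open>g\<close> fixes \<open>A\<^sub>g\<close>, which lies strictly between the
  positive fixed points of \<open>f\<close>. Distinctness makes the two choices at a given time
  disjoint events.\<close>

lemma f_neq_g: "f \<noteq> g"
  using F.fixed_cases[of "A\<^sub>g"] G.fixed_in(2) G.fixed(2) G.A_pos A_less A_less_K by auto

lemma orbit_X: "\<omega> \<in> space M \<Longrightarrow> orbit (\<lambda>n. X n \<omega>)"
  using H_cases[of \<omega>] X_0[of \<omega>] X_Suc[of \<omega>] x0_in unfolding orbit_def by metis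

lemma pred_H [measurable]: "Measurable.pred M (\<lambda>\<omega>. H n \<omega> = h)"
proof (cases "h \<in> {f, g}")
  case True
  then show ?thesis
    by measurable
next
  case False
  have "{\<omega> \<in> space M. H n \<omega> = h} = {}"
    using False H_cases by auto
  then show ?thesis
    unfolding pred_def by simp
qed

text \<open>Each \<open>X n\<close> has finitely many values, so even the discrete \<sigma>-algebra
  is admissible. Thus \<open>Q (X n \<omega>)\<close> is an event for arbitrary \<open>Q\<close>,
  and no regularity of \<open>f\<close> and \<open>g\<close> outside the state space enters.\<close>

lemma measurable_X_count_space: "X n \<in> M \<rightarrow>\<^sub>M count_space UNIV"
proof (induction n)
  case 0
  have "(\<lambda>_. x\<^sub>0) \<in> M \<rightarrow>\<^sub>M count_space UNIV"
    by simp
  then show ?case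
    using X_0 by (subst measurable_cong) auto
next
  case (Suc n)
  have [measurable]: "(\<lambda>\<omega>. h (X n \<omega>)) \<in> M \<rightarrow>\<^sub>M count_space UNIV" for h :: "real \<Rightarrow> real"
    by (rule measurable_compose[OF Suc]) simp
  have "{\<omega> \<in> space M. H n \<omega> = f} \<in> events"
    using pred_H[of n f] by (simp add: pred_def)
  then have "(\<lambda>\<omega>. if H n \<omega> = f then f (X n \<omega>) else g (X n \<omega>)) \<in> M \<rightarrow>\<^sub>M count_space UNIV"
    by (intro measurable_If) auto
  moreover have "(\<lambda>\<omega>. if H n \<omega> = f then f (X n \<omega>) else g (X n \<omega>)) \<omega> = X (Suc n) \<omega>"
    if "\<omega> \<in> space M" for \<omega>
    using H_cases[OF that, of n] X_Suc[OF that, of n] by auto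
  ultimately show ?case
    by (simp cong: measurable_cong)
qed

lemma pred_X [measurable]: "Measurable.pred M (\<lambda>\<omega>. Q (X n \<omega>))"
  using measurable_compose[OF measurable_X_count_space, of Q "count_space UNIV" n] by simp

lemma measurable_X [measurable]: "X n \<in> borel_measurable M"
  using measurable_compose[OF measurable_X_count_space, of "\<lambda>x. x" borel n] by simp

section \<open>Finite words of choices and the Markov property\<close>

definition weight :: "(real \<Rightarrow> real) \<Rightarrow> real" where
  "weight h = (if h = f then p else 1 - p)"

lemma prob_word:
  assumes "finite J" "\<And>i. i \<in> J \<Longrightarrow> w i \<in> {f, g}"
  shows "\<P>(\<omega> in M. \<forall>i\<in>J. H i \<omega> = w i) = (\<Prod>i\<in>J. weight (w i))"
\<comment> \<open>The empty word is separate because an intersection over no indices is the whole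
  type rather than \<open>space M\<close>.\<close>
proof (cases "J = {}")
  case True
  then show ?thesis
    by (simp add: prob_space)
next
  case False
  have "\<P>(\<omega> in M. \<forall>i\<in>J. H i \<omega> = w i) = prob (\<Inter>i\<in>J. H i -` {w i} \<inter> space M)"
    using False by (auto intro!: arg_cong[where f = prob])
  also have "\<dots> = (\<Prod>i\<in>J. prob (H i -` {w i} \<inter> space M))"
    using assms False by (intro indep_varsD[OF indep]) auto
  also have "\<dots> = (\<Prod>i\<in>J. weight (w i))"
  proof (rule prod.cong[OF refl])
    fix i assume i: "i \<in> J"
    have "H i -` {w i} \<inter> space M = {\<omega> \<in> space M. H i \<omega> = w i}"
      by auto
    then show "prob (H i -` {w i} \<inter> space M) = weight (w i)"
      using assms(2)[OF i] prob_f prob_g by (auto simp: weight_def)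
  qed
  finally show ?thesis .
qed

text \<open>The Markov property. Inducting on \<open>n\<close> for all words on times \<open>\<ge> n\<close> simultaneously avoids
  any reference to the past \<open>\<sigma>\<close>-algebra: the last choice is absorbed into the word.\<close>

lemma prob_state_and_word:
  assumes "finite J" "J \<subseteq> {n..}" "\<And>i. i \<in> J \<Longrightarrow> w i \<in> {f, g}"
  shows "\<P>(\<omega> in M. Q (X n \<omega>) \<and> (\<forall>i\<in>J. H i \<omega> = w i))
    = \<P>(\<omega> in M. Q (X n \<omega>)) * (\<Prod>i\<in>J. weight (w i))"
  using assms
proof (induction n arbitrary: Q J w)
  case 0
  have "\<P>(\<omega> in M. Q (X 0 \<omega>) \<and> (\<forall>i\<in>J. H i \<omega> = w i))
      = \<P>(\<omega> in M. Q x\<^sub>0 \<and> (\<forall>i\<in>J. H i \<omega> = w i))"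
    using X_0 by (intro arg_cong[where f = prob]) auto
  moreover have "\<P>(\<omega> in M. Q (X 0 \<omega>)) = \<P>(\<omega> in M. Q x\<^sub>0)"
    using X_0 by (intro arg_cong[where f = prob]) auto
  ultimately show ?case
    using prob_word[of J w] 0 by (cases "Q x\<^sub>0") (auto simp: prob_space)
next
  case (Suc n)
  \<comment> \<open>Conditioning on the choice at time \<open>n\<close>. The instance
    \<open>J = {}\<close> evaluates the probability of \<open>Q (X (Suc n) \<omega>)\<close> itself,
    and comparing it with the instance \<open>J\<close> gives the claim.\<close>
  have split: "\<P>(\<omega> in M. Q (X (Suc n) \<omega>) \<and> (\<forall>i\<in>J. H i \<omega> = w i))
      = (\<P>(\<omega> in M. Q (f (X n \<omega>))) * p + \<P>(\<omega> in M. Q (g (X n \<omega>))) * (1 - p))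
        * (\<Prod>i\<in>J. weight (w i))"
    if J: "finite J" "J \<subseteq> {Suc n..}" "\<And>i. i \<in> J \<Longrightarrow> w i \<in> {f, g}" for J w
  proof -
    have n: "n \<notin> J"
      using J by auto
    \<comment> \<open>The induction hypothesis is used with the predicate \<open>Q \<circ> h\<close>
      and the word extended by the letter \<open>h\<close> at time \<open>n\<close>.\<close>
    have part: "\<P>(\<omega> in M. Q (h (X n \<omega>)) \<and> (\<forall>i\<in>insert n J. H i \<omega> = (w(n := h)) i))
        = \<P>(\<omega> in M. Q (h (X n \<omega>))) * weight h * (\<Prod>i\<in>J. weight (w i))"
      if "h \<in> {f, g}" for h
    proof -
      have "\<P>(\<omega> in M. Q (h (X n \<omega>)) \<and> (\<forall>i\<in>insert n J. H i \<omega> = (w(n := h)) i))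
          = \<P>(\<omega> in M. Q (h (X n \<omega>))) * (\<Prod>i\<in>insert n J. weight ((w(n := h)) i))"
        using J(2) by (intro Suc.IH[of "insert n J" "w(n := h)" "\<lambda>y. Q (h y)"]) (use J that in \<open>auto dest: Suc_leD\<close>)
      moreover have "(\<Prod>i\<in>insert n J. weight ((w(n := h)) i)) = weight h * (\<Prod>i\<in>J. weight (w i))"
        using n J(1) by (auto intro!: arg_cong2[where f = "(*)"] prod.cong)
      ultimately show ?thesis
        by (simp only: mult.assoc)
    qed
    have "\<P>(\<omega> in M. Q (X (Suc n) \<omega>) \<and> (\<forall>i\<in>J. H i \<omega> = w i))
      = prob ({\<omega> \<in> space M. Q (f (X n \<omega>)) \<and> (\<forall>i\<in>insert n J. H i \<omega> = (w(n := f)) i)}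
         \<union> {\<omega> \<in> space M. Q (g (X n \<omega>)) \<and> (\<forall>i\<in>insert n J. H i \<omega> = (w(n := g)) i)})"
      using X_Suc H_cases n by (intro arg_cong[where f = prob]) force
    also have "\<dots> = \<P>(\<omega> in M. Q (f (X n \<omega>)) \<and> (\<forall>i\<in>insert n J. H i \<omega> = (w(n := f)) i))
      + \<P>(\<omega> in M. Q (g (X n \<omega>)) \<and> (\<forall>i\<in>insert n J. H i \<omega> = (w(n := g)) i))"
    proof (rule finite_measure_Union)
      have "finite (insert n J)" using J by simp
      then show "{\<omega> \<in> space M. Q (f (X n \<omega>)) \<and> (\<forall>i\<in>insert n J. H i \<omega> = (w(n := f)) i)} \<in> events"
        "{\<omega> \<in> space M. Q (g (X n \<omega>)) \<and> (\<forall>i\<in>insert n J. H i \<omega> = (w(n := g)) i)} \<in> events"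
        using pred_X[of "\<lambda>x. Q (f x)" n] pred_X[of "\<lambda>x. Q (g x)" n] by measurable
    qed (use f_neq_g in auto)
    finally show ?thesis
      using part[of f] part[of g] f_neq_g by (simp add: weight_def algebra_simps)
  qed
  show ?case
    using split[of J w] split[of "{}" w] Suc.prems by simp
qed

lemma prob_state_and_run:
  assumes "h \<in> {f, g}"
  shows "\<P>(\<omega> in M. Q (X n \<omega>) \<and> (\<forall>i\<in>{n..<n + k}. H i \<omega> = h))
    = \<P>(\<omega> in M. Q (X n \<omega>)) * weight h ^ k"
  using prob_state_and_word[of "{n..<n + k}" n "\<lambda>_. h" Q] assms by (force simp: subset_eq)

section \<open>Almost sure behaviour outside the middle interval\<close>

text \<open>A run of \<open>k\<close> equal choices from time \<open>m\<close> has probability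
  \<open>weight h ^ k\<close>, which tends to \<open>0\<close>; countably many starting times
  \<open>m\<close> are then combined.\<close>

lemma AE_not_eventually_constant:
  assumes h: "h \<in> {f, g}"
  shows "AE \<omega> in M. \<exists>\<^sub>\<infinity>n. H n \<omega> \<noteq> h"
proof -
  have "AE \<omega> in M. \<exists>n\<ge>m. H n \<omega> \<noteq> h" for m
  proof -
    let ?E = "{\<omega> \<in> space M. \<forall>n\<ge>m. H n \<omega> = h}"
    have "prob ?E \<le> weight h ^ k" for k
    proof -
      have "prob ?E \<le> \<P>(\<omega> in M. True \<and> (\<forall>i\<in>{m..<m + k}. H i \<omega> = h))"
        by (intro finite_measure_mono) auto
      then show ?thesis
        using prob_state_and_run[OF h, of "\<lambda>_. True" m k] by (simp add: prob_space)
    qed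
    moreover have "(\<lambda>k. weight h ^ k) \<longlonglongrightarrow> 0"
      using p_pos p_less_1 by (intro LIMSEQ_power_zero) (auto simp: weight_def)
    ultimately have "prob ?E \<le> 0"
      using LIMSEQ_le_const by blast
    then have "prob ?E = 0"
      using measure_nonneg[of M ?E] by simp
    moreover have "?E \<in> events"
      by measurable
    ultimately show ?thesis
      by (intro AE_I[of _ _ ?E]) (auto simp: emeasure_eq_measure)
  qed
  then have "AE \<omega> in M. \<forall>m. \<exists>n\<ge>m. H n \<omega> \<noteq> h"
    by (simp add: AE_all_countable)
  then show ?thesis
    by (simp add: cofinite_eq_sequentially frequently_sequentially)
qed

lemma AE_both_steps_infinitely_often:
  "AE \<omega> in M. (\<exists>\<^sub>\<infinity>n. X (Suc n) \<omega> = f (X n \<omega>)) \<and> (\<exists>\<^sub>\<infinity>n. X (Suc n) \<omega> = g (X n \<omega>))"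
  using AE_not_eventually_constant[of f, simplified] AE_not_eventually_constant[of g, simplified]
    AE_space
proof eventually_elim
  case (elim \<omega>)
  have f: "X (Suc n) \<omega> = f (X n \<omega>)" if "H n \<omega> \<noteq> g" for n
    using that H_cases[of \<omega> n] X_Suc[of \<omega> n] elim by auto
  have g: "X (Suc n) \<omega> = g (X n \<omega>)" if "H n \<omega> \<noteq> f" for n
    using that H_cases[of \<omega> n] X_Suc[of \<omega> n] elim by auto
  show ?case
    using frequently_elim1[OF elim(2) f] frequently_elim1[OF elim(1) g] by simp
qed

abbreviation "extinct \<equiv> \<lambda>\<omega>. (\<lambda>n. X n \<omega>) \<longlonglongrightarrow> 0"
abbreviation "persistent \<equiv> \<lambda>\<omega>. \<exists>n\<^sub>0. \<forall>n\<ge>n\<^sub>0. X n \<omega> \<in> {K\<^sub>f..K\<^sub>g}"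

lemma measurable_persistent [measurable]: "Measurable.pred M persistent"
  by measurable

lemma measurable_extinct [measurable]: "Measurable.pred M extinct"
  by measurable

text \<open>The time \<open>n\<close> is arbitrary because the moment of leaving the middle interval
  depends on the path.\<close>

lemma AE_low_imp_extinct: "AE \<omega> in M. X n \<omega> \<le> A\<^sub>f \<longrightarrow> extinct \<omega>"
  using AE_both_steps_infinitely_often AE_space
proof eventually_elim
  case (elim \<omega>)
  then show ?case
    using orbit_tendsto_0[OF orbit_X, of \<omega> n] by auto
qed

lemma AE_high_imp_persistent: "AE \<omega> in M. A\<^sub>g \<le> X n \<omega> \<longrightarrow> persistent \<omega>"
  using AE_both_steps_infinitely_often AE_space
proof eventually_elim
  case (elim \<omega>)
  then show ?case
    using orbit_eventually_between[OF orbit_X, of \<omega> n] by auto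
qed

lemma run_X:
  assumes "\<omega> \<in> space M" "\<forall>i\<in>{n..<n + k}. H i \<omega> = h"
  shows "X (n + k) \<omega> = (h ^^ k) (X n \<omega>)"
  using orbit_run[of n k "\<lambda>n. X n \<omega>" h] X_Suc assms by auto

section \<open>Geometric escape from the middle interval\<close>

abbreviation "I \<equiv> {A\<^sub>f<..<A\<^sub>g}"

text \<open>No single word expels all of \<open>I\<close>, since \<open>g ^^ l \<circ> f ^^ k\<close> may have a fixed point there;
  the escaping run is chosen according to the side of \<open>c\<close> on which the current state lies.\<close>

lemma prob_in_middle_decreases:
  obtains N q where "0 < q" "q \<le> 1"
    "\<And>n. \<P>(\<omega> in M. X (n + N) \<omega> \<in> I) \<le> (1 - q) * \<P>(\<omega> in M. X n \<omega> \<in> I)"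
proof -
  obtain c where c: "A\<^sub>f < c" "c < A\<^sub>g"
    using A_less dense by blast
  obtain N where N: "\<And>y. y \<in> S \<Longrightarrow> c \<le> y \<Longrightarrow> A\<^sub>g \<le> (f ^^ N) y"
      "\<And>y. y \<in> S \<Longrightarrow> y \<le> c \<Longrightarrow> (g ^^ N) y \<le> A\<^sub>f"
    using uniform_escape[OF c] by blast
  \<comment> \<open>A lower bound for the probability of a run of length \<open>N\<close> of either
    map.\<close>
  define q where "q = min p (1 - p) ^ N"
  have q: "0 < q" "q \<le> 1" "q \<le> weight f ^ N" "q \<le> weight g ^ N"
    using p_pos p_less_1 f_neq_g
    by (auto simp: q_def weight_def intro!: power_mono power_le_one)
  have "\<P>(\<omega> in M. X (n + N) \<omega> \<in> I) \<le> (1 - q) * \<P>(\<omega> in M. X n \<omega> \<in> I)" for n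
  proof -
    define up where "up = {\<omega> \<in> space M. (X n \<omega> \<in> I \<and> c \<le> X n \<omega>) \<and> (\<forall>i\<in>{n..<n + N}. H i \<omega> = f)}"
    define down where "down = {\<omega> \<in> space M. (X n \<omega> \<in> I \<and> X n \<omega> < c) \<and> (\<forall>i\<in>{n..<n + N}. H i \<omega> = g)}"
    define stay where "stay = {\<omega> \<in> space M. X (n + N) \<omega> \<in> I}"
    have [measurable]: "up \<in> events" "down \<in> events" "stay \<in> events"
      unfolding up_def down_def stay_def by measurable
    have up_exit: "A\<^sub>g \<le> X (n + N) \<omega>" if "\<omega> \<in> up" for \<omega>
      using that N(1)[of "X n \<omega>"] run_X[of \<omega> n N f] orbit_closed[OF orbit_X, of \<omega> n]
      by (auto simp: up_def)
    have down_exit: "X (n + N) \<omega> \<le> A\<^sub>f" if "\<omega> \<in> down" for \<omega>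
      using that N(2)[of "X n \<omega>"] run_X[of \<omega> n N g] orbit_closed[OF orbit_X, of \<omega> n]
      by (auto simp: down_def)
    \<comment> \<open>By invariance of the low and high regions, a path inside \<open>I\<close> at
      the later time cannot have been outside before.\<close>
    have stay_in: "X n \<omega> \<in> I" if "\<omega> \<in> stay" for \<omega>
      using that orbit_stays_low[OF orbit_X, of \<omega> n N] orbit_stays_high[OF orbit_X, of \<omega> n N]
      by (force simp: stay_def not_le[symmetric])
    \<comment> \<open>The paths in \<open>I\<close> at time \<open>n\<close> include three disjoint
      classes: those still inside at time \<open>n + N\<close>, and those expelled upwards or
      downwards by a full run.\<close>
    have "prob stay + (prob up + prob down) = prob (stay \<union> (up \<union> down))"
    proof -
      have "up \<inter> down = {}" "stay \<inter> (up \<union> down) = {}"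
        using up_exit down_exit by (fastforce simp: up_def down_def stay_def)+
      then show ?thesis
        by (simp add: finite_measure_Union)
    qed
    also have "\<dots> \<le> \<P>(\<omega> in M. X n \<omega> \<in> I)"
      using stay_in by (intro finite_measure_mono) (auto simp: up_def down_def stay_def)
    finally have "prob stay + (prob up + prob down) \<le> \<P>(\<omega> in M. X n \<omega> \<in> I)" .
    \<comment> \<open>On either side of \<open>c\<close> the Markov property gives the expelling run
      a conditional probability of at least \<open>q\<close>.\<close>
    moreover have "q * \<P>(\<omega> in M. X n \<omega> \<in> I) \<le> prob up + prob down"
    proof -
      let ?hi = "{\<omega> \<in> space M. X n \<omega> \<in> I \<and> c \<le> X n \<omega>}"
      let ?lo = "{\<omega> \<in> space M. X n \<omega> \<in> I \<and> X n \<omega> < c}"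
      have "\<P>(\<omega> in M. X n \<omega> \<in> I) = prob (?hi \<union> ?lo)"
        by (intro arg_cong[where f = prob]) auto
      also have "\<dots> = prob ?hi + prob ?lo"
        by (rule finite_measure_Union) auto
      finally have "q * \<P>(\<omega> in M. X n \<omega> \<in> I) = prob ?hi * q + prob ?lo * q"
        by (simp add: algebra_simps)
      also have "\<dots> \<le> prob ?hi * weight f ^ N + prob ?lo * weight g ^ N"
        using q by (intro add_mono mult_left_mono) auto
      also have "\<dots> = prob up + prob down"
        using prob_state_and_run[of f "\<lambda>x. x \<in> I \<and> c \<le> x" n N]
          prob_state_and_run[of g "\<lambda>x. x \<in> I \<and> x < c" n N]
        by (simp add: up_def down_def)
      finally show ?thesis .
    qed
    ultimately show ?thesis
      by (simp add: stay_def algebra_simps)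
  qed
  then show ?thesis
    using that q by blast
qed

text \<open>Iterating the contraction along the times \<open>k * N\<close> bounds the probability of
  never leaving by \<open>(1 - q) ^ k\<close> for every \<open>k\<close>.\<close>

lemma AE_leaves_middle: "AE \<omega> in M. \<exists>n. X n \<omega> \<notin> I"
proof -
  obtain N q where q: "0 < q" "q \<le> 1"
    and dec: "\<And>n. \<P>(\<omega> in M. X (n + N) \<omega> \<in> I) \<le> (1 - q) * \<P>(\<omega> in M. X n \<omega> \<in> I)"
    using prob_in_middle_decreases by blast
  let ?E = "{\<omega> \<in> space M. \<forall>n. X n \<omega> \<in> I}"
  have bound: "\<P>(\<omega> in M. X (k * N) \<omega> \<in> I) \<le> (1 - q) ^ k" for k
  proof (induction k)
    case (Suc k)
    have "\<P>(\<omega> in M. X (Suc k * N) \<omega> \<in> I) \<le> (1 - q) * \<P>(\<omega> in M. X (k * N) \<omega> \<in> I)"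
      using dec[of "k * N"] by (simp add: add.commute)
    also have "\<dots> \<le> (1 - q) * (1 - q) ^ k"
      using Suc q by (intro mult_left_mono) auto
    finally show ?case
      by simp
  qed simp
  have "prob ?E \<le> (1 - q) ^ k" for k
    by (rule order_trans[OF finite_measure_mono bound[of k]]) auto
  moreover have "(\<lambda>k. (1 - q) ^ k) \<longlonglongrightarrow> 0"
    using q by (intro LIMSEQ_power_zero) auto
  ultimately have "prob ?E \<le> 0"
    using LIMSEQ_le_const by blast
  then have "prob ?E = 0"
    using measure_nonneg[of M ?E] by (rule antisym)
  moreover have "?E \<in> events"
    by measurable
  ultimately show ?thesis
    by (intro AE_I[of _ _ ?E]) (auto simp: emeasure_eq_measure)
qed

section \<open>Probabilities of extinction and persistence\<close>

lemma prob_extinct_low: "x\<^sub>0 \<le> A\<^sub>f \<Longrightarrow> \<P>(\<omega> in M. extinct \<omega>) = 1"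
proof (subst prob_Collect_eq_1)
  assume *: "x\<^sub>0 \<le> A\<^sub>f"
  show "AE \<omega> in M. extinct \<omega>"
    using AE_low_imp_extinct[of 0] AE_space by eventually_elim (use * in \<open>simp add: X_0\<close>)
qed measurable

lemma prob_persistent_high: "A\<^sub>g \<le> x\<^sub>0 \<Longrightarrow> \<P>(\<omega> in M. persistent \<omega>) = 1"
proof (subst prob_Collect_eq_1)
  assume *: "A\<^sub>g \<le> x\<^sub>0"
  show "AE \<omega> in M. persistent \<omega>"
    using AE_high_imp_persistent[of 0] AE_space by eventually_elim (use * in \<open>simp add: X_0\<close>)
qed measurable

lemma prob_run_pos:
  assumes "h \<in> {f, g}"
  shows "0 < \<P>(\<omega> in M. \<forall>i\<in>{0..<k}. H i \<omega> = h)"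
  using prob_state_and_run[OF assms, of "\<lambda>_. True" 0 k] p_pos p_less_1
  by (simp add: prob_space weight_def)

text \<open>A sufficiently long initial run of \<open>g\<close> has positive probability and brings
  \<open>x\<^sub>0\<close> into the low region, from which extinction is almost sure.\<close>

lemma prob_extinct_pos:
  assumes "x\<^sub>0 < A\<^sub>g"
  shows "0 < \<P>(\<omega> in M. extinct \<omega>)"
proof -
  obtain k where k: "(g ^^ k) x\<^sub>0 \<le> A\<^sub>f"
    using G.iterates_drop_below[OF x0_in assms F.A_pos] by blast
  have "AE \<omega> in M. (\<forall>i\<in>{0..<k}. H i \<omega> = g) \<longrightarrow> extinct \<omega>"
    using AE_low_imp_extinct[of k] AE_space
  proof eventually_elim
    case (elim \<omega>)
    then show ?case
      using run_X[of \<omega> 0 k g] k X_0[of \<omega>] by auto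
  qed
  then have "\<P>(\<omega> in M. \<forall>i\<in>{0..<k}. H i \<omega> = g) \<le> \<P>(\<omega> in M. extinct \<omega>)"
    by (intro finite_measure_mono_AE) auto
  then show ?thesis
    using prob_run_pos[of g k] by simp
qed

text \<open>Likewise an initial run of \<open>f\<close> reaches the high region, since
  \<open>A\<^sub>g\<close> lies below \<open>K\<^sub>f\<close>.\<close>

lemma prob_persistent_pos:
  assumes "A\<^sub>f < x\<^sub>0"
  shows "0 < \<P>(\<omega> in M. persistent \<omega>)"
proof -
  obtain k where k: "A\<^sub>g \<le> (f ^^ k) x\<^sub>0"
    using F.iterates_rise_above[OF x0_in assms A_less_K] by blast
  have "AE \<omega> in M. (\<forall>i\<in>{0..<k}. H i \<omega> = f) \<longrightarrow> persistent \<omega>"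
    using AE_high_imp_persistent[of k] AE_space
  proof eventually_elim
    case (elim \<omega>)
    then show ?case
      using run_X[of \<omega> 0 k f] k X_0[of \<omega>] by auto
  qed
  then have "\<P>(\<omega> in M. \<forall>i\<in>{0..<k}. H i \<omega> = f) \<le> \<P>(\<omega> in M. persistent \<omega>)"
    by (intro finite_measure_mono_AE) auto
  then show ?thesis
    using prob_run_pos[of f k] by simp
qed

lemma not_extinct_and_persistent: "\<not> (extinct \<omega> \<and> persistent \<omega>)"
proof
  assume *: "extinct \<omega> \<and> persistent \<omega>"
  then have "K\<^sub>f \<le> 0"
    by (intro LIMSEQ_le_const[of "\<lambda>n. X n \<omega>"]) auto
  then show False
    using F.A_pos F.A_less_K by simp
qed

lemma prob_extinct_plus_persistent: "\<P>(\<omega> in M. extinct \<omega>) + \<P>(\<omega> in M. persistent \<omega>) = 1"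
proof -
  \<comment> \<open>Collecting the null sets of all times \<open>n\<close> into one allows
    \<open>n\<close> to be the path-dependent exit time.\<close>
  have "AE \<omega> in M. \<forall>n. X n \<omega> \<le> A\<^sub>f \<longrightarrow> extinct \<omega>"
    "AE \<omega> in M. \<forall>n. A\<^sub>g \<le> X n \<omega> \<longrightarrow> persistent \<omega>"
    unfolding AE_all_countable using AE_low_imp_extinct AE_high_imp_persistent by blast+
  then have "AE \<omega> in M. extinct \<omega> \<or> persistent \<omega>"
    using AE_leaves_middle
  proof eventually_elim
    case (elim \<omega>)
    then show ?case
      by (metis greaterThanLessThan_iff not_le)
  qed
  then have "\<P>(\<omega> in M. extinct \<omega> \<or> persistent \<omega>) = 1"
    by (subst prob_Collect_eq_1) measurable
  also have "\<P>(\<omega> in M. extinct \<omega> \<or> persistent \<omega>)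
      = prob ({\<omega> \<in> space M. extinct \<omega>} \<union> {\<omega> \<in> space M. persistent \<omega>})"
    by (intro arg_cong[where f = prob]) auto
  also have "\<dots> = \<P>(\<omega> in M. extinct \<omega>) + \<P>(\<omega> in M. persistent \<omega>)"
    using not_extinct_and_persistent by (intro finite_measure_Union) auto
  finally show ?thesis
    by simp
qed

end

theorem theorem1:
  fixes b :: ereal
    and f g :: "real \<Rightarrow> real"
    and A\<^sub>f K\<^sub>f A\<^sub>g K\<^sub>g p x\<^sub>0 p\<^sub>0 p\<^sub>1 :: real
    and M :: "'a measure"
    and H :: "nat \<Rightarrow> 'a \<Rightarrow> (real \<Rightarrow> real)"
    and X :: "nat \<Rightarrow> 'a \<Rightarrow> real"
  assumes "0 < b"
    and "allee_map b f A\<^sub>f K\<^sub>f"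
    and "continuous_on (state_space b) f" and "strict_mono_on (state_space b) f"
    and "allee_map b g A\<^sub>g K\<^sub>g"
    and "continuous_on (state_space b) g" and "strict_mono_on (state_space b) g"
    and "A\<^sub>f < A\<^sub>g" and "A\<^sub>g < K\<^sub>f" and "K\<^sub>f < K\<^sub>g"
    and "0 < p" and "p < 1"
    and "prob_space M"
    and "prob_space.indep_vars M (\<lambda>_. count_space {f, g}) H UNIV"
    and "\<And>n. measure M {\<omega> \<in> space M. H n \<omega> = f} = p"
    and "\<And>n. measure M {\<omega> \<in> space M. H n \<omega> = g} = 1 - p"
    and "x\<^sub>0 \<in> state_space b"
    and "\<And>\<omega>. \<omega> \<in> space M \<Longrightarrow> X 0 \<omega> = x\<^sub>0"
    and "\<And>n \<omega>. \<omega> \<in> space M \<Longrightarrow> X (Suc n) \<omega> = H n \<omega> (X n \<omega>)"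
    and "p\<^sub>0 = measure M {\<omega> \<in> space M. (\<lambda>n. X n \<omega>) \<longlonglongrightarrow> 0}"
    and "p\<^sub>1 = measure M {\<omega> \<in> space M. \<exists>n\<^sub>0. \<forall>n\<ge>n\<^sub>0. X n \<omega> \<in> {K\<^sub>f..K\<^sub>g}}"
  shows "(x\<^sub>0 \<le> A\<^sub>f \<longrightarrow> p\<^sub>0 = 1) \<and>
         (A\<^sub>g \<le> x\<^sub>0 \<longrightarrow> p\<^sub>1 = 1) \<and>
         (x\<^sub>0 \<in> {A\<^sub>f<..<A\<^sub>g} \<longrightarrow> 0 < p\<^sub>0 \<and> 0 < p\<^sub>1 \<and> p\<^sub>0 + p\<^sub>1 = 1)"
proof -
  interpret prob_space M
    by fact
  interpret random_allee_system b f g A\<^sub>f K\<^sub>f A\<^sub>g K\<^sub>g M p x\<^sub>0 H X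
    using assms by unfold_locales auto
  show ?thesis
    using prob_extinct_low prob_persistent_high prob_extinct_pos prob_persistent_pos
      prob_extinct_plus_persistent assms(20,21) by auto
qed

end
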